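(* Let $A:\Omega\to\mathbb{R}$ be a Lipschitz (or, more generally, Hölder) potential and suppose $\Phi$ is transitive (there is a point whose $\Phi$-orbit is dense in $\Omega$). Then $A$ is a coboundary, i.e. $A=h-h\circ\Phi$ for some continuous $h:\Omega\to\mathbb{R}$, if and only if for every $n\ge1$ and every point $x\in\Omega$ with $\Phi^n(x)=x$ we have $S_nA(x)=0$.
   Context: $\mathcal{A}=\{1,\dots,r\}$, $\Omega=\mathcal{A}^{\mathbb{N}}$ with metric $d(x,x')=\theta^N$, where $0<\theta<1$ is fixed and $N\ge1$ is the first index with $x_N\ne x'_N$ ($d(x,x)=0$). $\phi:\mathcal{A}\times\mathcal{A}\to\mathcal{A}$ is a local rule such that $b\mapsto\phi(a,b)$ is bijective for every fixed $a$, and $\Phi(x_1,x_2,x_3,\dots)=(\phi(x_1,x_2),\phi(x_2,x_3),\dots)$. $S_nA(x)=\sum_{k=0}^{n-1}A(\Phi^k(x))$. *)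

theory Defs
  imports "HOL-Analysis.Analysis"
begin

text \<open>
  Sequences are indexed from 0, so \<open>x i\<close> is the coordinate \<open>x\<^sub>i\<^sub>+\<^sub>1\<close> of the usual
  one-based notation \<open>x = (x\<^sub>1, x\<^sub>2, \<dots>)\<close>.
\<close>

definition Omega :: "nat \<Rightarrow> (nat \<Rightarrow> nat) set" where
  "Omega r = {x. \<forall>i. x i \<in> {1..r}}"

text \<open>
  The exponent is the one-based position of the first difference, hence the \<open>Suc\<close>.
\<close>

definition seq_dist :: "real \<Rightarrow> (nat \<Rightarrow> 'a) \<Rightarrow> (nat \<Rightarrow> 'a) \<Rightarrow> real" where
  "seq_dist \<theta> x y = (if x = y then 0 else \<theta> ^ Suc (LEAST i. x i \<noteq> y i))"

lemma Metric_space_seq_dist: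
  fixes M :: "(nat \<Rightarrow> 'a) set"
  assumes "0 < \<theta>" "\<theta> < 1"
  shows "Metric_space M (seq_dist \<theta>)"
proof
  show "0 \<le> seq_dist \<theta> x y" for x y :: "nat \<Rightarrow> 'a"
    using assms by (simp add: seq_dist_def)
  show "seq_dist \<theta> x y = seq_dist \<theta> y x" for x y :: "nat \<Rightarrow> 'a"
  proof -
    have "(\<lambda>i. x i \<noteq> y i) = (\<lambda>i. y i \<noteq> x i)" by (rule ext) (rule neq_commute)
    then show ?thesis unfolding seq_dist_def by presburger
  qed
  show "(seq_dist \<theta> x y = 0) = (x = y)" for x y :: "nat \<Rightarrow> 'a"
    using assms by (simp add: seq_dist_def)
  show "seq_dist \<theta> x z \<le> seq_dist \<theta> x y + seq_dist \<theta> y z" for x y z :: "nat \<Rightarrow> 'a"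
  proof (cases "x = y \<or> y = z \<or> x = z")
    case True
    then show ?thesis using assms by (auto simp: seq_dist_def)
  next
    case False
    define n where "n = (LEAST i. x i \<noteq> z i)"
    have "\<exists>i. x i \<noteq> z i"
      using False by (simp add: fun_eq_iff)
    then have "x n \<noteq> z n"
      unfolding n_def by (rule LeastI_ex)
    then have "x n \<noteq> y n \<or> y n \<noteq> z n" by auto
    then have "(LEAST i. x i \<noteq> y i) \<le> n \<or> (LEAST i. y i \<noteq> z i) \<le> n"
      by (blast intro: Least_le)
    moreover have "\<theta> ^ Suc n \<le> \<theta> ^ Suc k" if "k \<le> n" for k
      by (rule power_decreasing) (use assms that in auto)
    moreover have "0 \<le> \<theta> ^ Suc k" for k
      by (rule zero_le_power) (use assms in simp)
    ultimately have "\<theta> ^ Suc n \<le> \<theta> ^ Suc (LEAST i. x i \<noteq> y i) + \<theta> ^ Suc (LEAST i. y i \<noteq> z i)"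
      by (elim disjE) (auto intro: add_increasing add_increasing2 simp del: power_Suc)
    with False show ?thesis by (simp add: seq_dist_def n_def del: power_Suc)
  qed
qed

definition Omega_top :: "nat \<Rightarrow> real \<Rightarrow> (nat \<Rightarrow> nat) topology" where
  "Omega_top r \<theta> = Metric_space.mtopology (Omega r) (seq_dist \<theta>)"

definition cellular_map :: "('a \<Rightarrow> 'a \<Rightarrow> 'a) \<Rightarrow> (nat \<Rightarrow> 'a) \<Rightarrow> (nat \<Rightarrow> 'a)" where
  "cellular_map \<phi> x = (\<lambda>i. \<phi> (x i) (x (Suc i)))"

definition birkhoff_sum :: "('b \<Rightarrow> 'b) \<Rightarrow> ('b \<Rightarrow> real) \<Rightarrow> nat \<Rightarrow> 'b \<Rightarrow> real" where
  "birkhoff_sum f A n x = (\<Sum>k<n. A ((f ^^ k) x))"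

definition has_dense_orbit :: "'b topology \<Rightarrow> ('b \<Rightarrow> 'b) \<Rightarrow> bool" where
  "has_dense_orbit T f \<longleftrightarrow>
     (\<exists>x \<in> topspace T. T closure_of (range (\<lambda>k. (f ^^ k) x)) = topspace T)"

definition is_coboundary :: "'b topology \<Rightarrow> ('b \<Rightarrow> 'b) \<Rightarrow> ('b \<Rightarrow> real) \<Rightarrow> bool" where
  "is_coboundary T f A \<longleftrightarrow>
     (\<exists>h. continuous_map T euclideanreal h \<and> (\<forall>x \<in> topspace T. A x = h x - h (f x)))"

definition holder_on :: "'b set \<Rightarrow> ('b \<Rightarrow> 'b \<Rightarrow> real) \<Rightarrow> ('b \<Rightarrow> real) \<Rightarrow> bool" where
  "holder_on M d A \<longleftrightarrow>
     (\<exists>C \<alpha>. 0 < \<alpha> \<and> \<alpha> \<le> 1 \<and> (\<forall>x\<in>M. \<forall>y\<in>M. \<bar>A x - A y\<bar> \<le> C * d x y powr \<alpha>))"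

text \<open>Lipschitz potentials are the case \<open>\<alpha> = 1\<close>, so statements about \<open>holder_on\<close> cover them.\<close>

lemma Lipschitz_imp_holder_on:
  assumes "Metric_space M d"
    and "Lipschitz_continuous_map (metric (M, d)) euclidean_metric A"
  shows "holder_on M d A"
proof -
  interpret Metric_space M d by fact
  from assms(2) have "\<exists>B. \<forall>x\<in>M. \<forall>y\<in>M. \<bar>A x - A y\<bar> \<le> B * d x y"
    unfolding Lipschitz_continuous_map_def mspace_metric mdist_metric mdist_euclidean_metric
      dist_real_def by (rule conjunct2)
  then obtain B where "\<forall>x\<in>M. \<forall>y\<in>M. \<bar>A x - A y\<bar> \<le> B * d x y" ..
  then show ?thesis
    unfolding holder_on_def by (intro exI[of _ B] exI[of _ 1]) simp
qed

end

theory Submission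
  imports Defs
begin

text \<open>
  Since \<open>\<phi>\<close> is permutive, \<open>x \<mapsto> (x\<^sub>0, (\<Phi> x)\<^sub>0, (\<Phi>\<^sup>2 x)\<^sub>0, \<dots>)\<close> is a bijective isometry of \<open>\<Omega>\<close> that
  conjugates \<open>\<Phi>\<close> to the full shift \<open>\<sigma>\<close>. On the full shift, fix a letter \<open>e\<close> and write \<open>B\<close> for the
  transported potential; its transfer function is \<open>h(x) = - \<Sum>\<^sub>k B(e\<^sup>k x)\<close>, summed over \<open>k \<ge> 1\<close>.
  The periodic data show that \<open>h(x)\<close> is also the limit of the orbit sums
  \<open>S\<^sub>m B(x\<^sub>0 \<dots> x\<^sub>m\<^sub>-\<^sub>1 e\<^sup>\<infinity>)\<close>, from which \<open>B = h - h \<circ> \<sigma>\<close> can be read off.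
\<close>

section \<open>Hoelder functions and agreeing prefixes\<close>

text \<open>Hoelder continuity without the metric: only the length of a common prefix enters, so the
  property passes, with the same constants, through any map that preserves common prefixes.\<close>

definition geometric_modulus :: "(nat \<Rightarrow> 'a) set \<Rightarrow> real \<Rightarrow> real \<Rightarrow> ((nat \<Rightarrow> 'a) \<Rightarrow> real) \<Rightarrow> bool" where
  "geometric_modulus M D \<rho> f \<longleftrightarrow>
     (\<forall>x\<in>M. \<forall>y\<in>M. \<forall>n. (\<forall>i<n. x i = y i) \<longrightarrow> \<bar>f x - f y\<bar> \<le> D * \<rho> ^ n)"

lemma geometric_modulusD:
  assumes "geometric_modulus M D \<rho> f" "x \<in> M" "y \<in> M" "\<And>i. i < n \<Longrightarrow> x i = y i"
  shows "\<bar>f x - f y\<bar> \<le> D * \<rho> ^ n"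
  using assms unfolding geometric_modulus_def by blast

lemma seq_dist_le:
  assumes "0 < \<theta>" "\<theta> < 1" "\<And>i. i < n \<Longrightarrow> x i = y i"
  shows "seq_dist \<theta> x y \<le> \<theta> ^ Suc n"
proof (cases "x = y")
  case False
  then have "\<exists>i. x i \<noteq> y i"
    by (simp add: fun_eq_iff)
  then have neq: "x (LEAST i. x i \<noteq> y i) \<noteq> y (LEAST i. x i \<noteq> y i)"
    by (rule LeastI_ex)
  have "n \<le> (LEAST i. x i \<noteq> y i)"
  proof (rule leI, rule notI)
    assume "(LEAST i. x i \<noteq> y i) < n"
    then have "x (LEAST i. x i \<noteq> y i) = y (LEAST i. x i \<noteq> y i)"
      by (rule assms(3))
    with neq show False ..
  qed
  then have "\<theta> ^ Suc (LEAST i. x i \<noteq> y i) \<le> \<theta> ^ Suc n"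
    using assms(1,2) by (intro power_decreasing) auto
  with False show ?thesis by (simp add: seq_dist_def)
qed (use assms in \<open>simp add: seq_dist_def\<close>)

lemma seq_dist_less_imp_agree:
  assumes "0 < \<theta>" "\<theta> < 1" "seq_dist \<theta> x y < \<theta> ^ n" "i < n"
  shows "x i = y i"
proof (rule ccontr)
  assume *: "x i \<noteq> y i"
  then have "Suc (LEAST i. x i \<noteq> y i) \<le> n"
    using Least_le[of "\<lambda>i. x i \<noteq> y i" i] assms(4) by simp
  then have "\<theta> ^ n \<le> \<theta> ^ Suc (LEAST i. x i \<noteq> y i)"
    using assms(1,2) by (intro power_decreasing) auto
  moreover have "seq_dist \<theta> x y = \<theta> ^ Suc (LEAST i. x i \<noteq> y i)"
    using * by (auto simp: seq_dist_def)
  ultimately show False using assms(3) by simp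
qed

lemma holder_on_imp_geometric_modulus:
  assumes \<theta>: "0 < \<theta>" "\<theta> < 1" and "holder_on M (seq_dist \<theta>) A"
  obtains D \<rho> where "0 < \<rho>" "\<rho> < 1" "geometric_modulus M D \<rho> A"
proof -
  obtain C \<alpha> where \<alpha>: "0 < \<alpha>"
    and C: "\<And>x y. x \<in> M \<Longrightarrow> y \<in> M \<Longrightarrow> \<bar>A x - A y\<bar> \<le> C * seq_dist \<theta> x y powr \<alpha>"
    using assms(3) unfolding holder_on_def by blast
  \<comment> \<open>This choice turns \<open>(\<theta> ^ n) powr \<alpha>\<close> into
    \<open>\<rho> ^ n\<close>, so the Hoelder exponent is absorbed into the base.\<close>
  define \<rho> where "\<rho> = \<theta> powr \<alpha>"
  have \<rho>: "0 < \<rho>" "\<rho> < 1"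
    using \<theta> \<alpha> powr_less_mono2[of \<alpha> \<theta> 1] by (auto simp: \<rho>_def)
  \<comment> \<open>The sign of \<open>C\<close> is not prescribed; passing to
    \<open>\<bar>C\<bar>\<close> makes multiplication monotone.\<close>
  have "\<bar>A x - A y\<bar> \<le> \<bar>C\<bar> * \<rho> ^ n"
    if xy: "x \<in> M" "y \<in> M" and agree: "\<forall>i<n. x i = y i" for x y n
  proof -
    have "seq_dist \<theta> x y \<le> \<theta> ^ n"
    proof (rule order_trans)
      show "seq_dist \<theta> x y \<le> \<theta> ^ Suc n"
        using agree by (intro seq_dist_le \<theta>) auto
      show "\<theta> ^ Suc n \<le> \<theta> ^ n"
        using \<theta> by (intro power_decreasing) auto
    qed
    moreover have "0 \<le> seq_dist \<theta> x y"
      using \<theta> by (simp add: seq_dist_def)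
    ultimately have "seq_dist \<theta> x y powr \<alpha> \<le> (\<theta> ^ n) powr \<alpha>"
      using \<alpha> by (intro powr_mono2) auto
    also have "\<dots> = \<rho> ^ n"
      using \<theta> by (simp add: \<rho>_def powr_realpow[symmetric] powr_powr mult.commute)
    finally have "\<bar>C\<bar> * seq_dist \<theta> x y powr \<alpha> \<le> \<bar>C\<bar> * \<rho> ^ n"
      by (intro mult_left_mono) auto
    moreover have "C * seq_dist \<theta> x y powr \<alpha> \<le> \<bar>C\<bar> * seq_dist \<theta> x y powr \<alpha>"
      by (intro mult_right_mono) auto
    ultimately show ?thesis using C[OF xy] by linarith
  qed
  then show ?thesis
    using that \<rho> unfolding geometric_modulus_def by blast
qed

text \<open>Points closer than \<open>\<theta> ^ n\<close> share their first \<open>n\<close>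
  coordinates, so their values differ by at most \<open>D * \<rho> ^ n\<close>, which tends to
  0.\<close>

lemma continuous_map_geometric_modulus:
  assumes \<theta>: "0 < \<theta>" "\<theta> < 1" and \<rho>: "0 < \<rho>" "\<rho> < 1"
    and f: "geometric_modulus M D \<rho> f"
  shows "continuous_map (Metric_space.mtopology M (seq_dist \<theta>)) euclideanreal f"
proof -
  interpret Metric_space M "seq_dist \<theta>"
    by (rule Metric_space_seq_dist[OF \<theta>])
  have "\<exists>\<delta>>0. \<forall>y. y \<in> M \<and> seq_dist \<theta> x y < \<delta> \<longrightarrow> dist (f x) (f y) < \<epsilon>"
    if "x \<in> M" "0 < \<epsilon>" for x \<epsilon>
  proof -
    have "(\<lambda>n. D * \<rho> ^ n) \<longlonglongrightarrow> D * 0"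
      using \<rho> by (intro tendsto_intros LIMSEQ_power_zero) auto
    then have "eventually (\<lambda>n. D * \<rho> ^ n < \<epsilon>) sequentially"
      using that(2) by (intro order_tendstoD) auto
    then obtain n where n: "D * \<rho> ^ n < \<epsilon>"
      by (auto simp: eventually_sequentially)
    have "dist (f x) (f y) < \<epsilon>" if "y \<in> M" "seq_dist \<theta> x y < \<theta> ^ n" for y
    proof -
      have "\<bar>f x - f y\<bar> \<le> D * \<rho> ^ n"
        by (intro geometric_modulusD[OF f] seq_dist_less_imp_agree[OF \<theta> that(2)] that(1) \<open>x \<in> M\<close>)
      with n show ?thesis by (simp add: dist_real_def)
    qed
    then show ?thesis
      using \<theta> by (intro exI[of _ "\<theta> ^ n"]) auto
  qed
  then show ?thesis
    using metric_continuous_map[OF Met_TC.Metric_space_axioms, of f] by auto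
qed

lemma funpow_in:
  assumes "f \<in> M \<rightarrow> M" "x \<in> M"
  shows "(f ^^ n) x \<in> M"
  using assms by (induction n) auto

text \<open>The sum telescopes; at a periodic point the two remaining terms cancel.\<close>

lemma birkhoff_sum_coboundary:
  assumes "f \<in> M \<rightarrow> M" "x \<in> M" "\<And>x. x \<in> M \<Longrightarrow> A x = h x - h (f x)"
  shows "birkhoff_sum f A n x = h x - h ((f ^^ n) x)"
  using assms(3)[OF funpow_in[OF assms(1,2)]]
  by (induction n) (auto simp: birkhoff_sum_def)

lemma sum_lessThan_add:
  fixes f :: "nat \<Rightarrow> 'a::comm_monoid_add"
  shows "(\<Sum>k<m + n. f k) = (\<Sum>k<m. f k) + (\<Sum>k<n. f (m + k))"
  by (induction n) (auto simp: add.assoc)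

section \<open>The full shift: a transfer function from periodic data\<close>

definition shift :: "(nat \<Rightarrow> 'a) \<Rightarrow> nat \<Rightarrow> 'a" where
  "shift x = (\<lambda>i. x (Suc i))"

lemma funpow_shift: "(shift ^^ n) x = (\<lambda>i. x (n + i))"
  by (induction n) (auto simp: shift_def)

text \<open>For growing \<open>k\<close> these points form a backward orbit of \<open>x\<close>
  converging to the fixed point \<open>\<lambda>_. e\<close>.\<close>

definition prepend_const :: "'a \<Rightarrow> nat \<Rightarrow> (nat \<Rightarrow> 'a) \<Rightarrow> nat \<Rightarrow> 'a" where
  "prepend_const e k x = (\<lambda>i. if i < k then e else x (i - k))"

text \<open>An approximation of \<open>x\<close> whose forward orbit lands on the fixed point
  \<open>\<lambda>_. e\<close> after \<open>m\<close> steps.\<close>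

definition truncate_const :: "'a \<Rightarrow> nat \<Rightarrow> (nat \<Rightarrow> 'a) \<Rightarrow> nat \<Rightarrow> 'a" where
  "truncate_const e m x = (\<lambda>i. if i < m then x i else e)"

locale shift_potential =
  fixes S :: "'a set" and e :: 'a and B :: "(nat \<Rightarrow> 'a) \<Rightarrow> real" and D \<rho> :: real
  assumes e_in: "e \<in> S"
    and \<rho>: "0 < \<rho>" "\<rho> < 1"
    and modulus: "geometric_modulus (UNIV \<rightarrow> S) D \<rho> B"
    and periodic: "\<And>n x. 1 \<le> n \<Longrightarrow> x \<in> UNIV \<rightarrow> S \<Longrightarrow> (shift ^^ n) x = x \<Longrightarrow>
      birkhoff_sum shift B n x = 0"
begin

abbreviation X :: "(nat \<Rightarrow> 'a) set" where "X \<equiv> UNIV \<rightarrow> S"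

lemma shift_in: "x \<in> X \<Longrightarrow> (\<lambda>i. x (n + i)) \<in> X"
  and prepend_in: "x \<in> X \<Longrightarrow> prepend_const e k x \<in> X"
  and truncate_in: "x \<in> X \<Longrightarrow> truncate_const e k x \<in> X"
  using e_in by (auto simp: prepend_const_def truncate_const_def Pi_iff)

lemma D_nonneg: "0 \<le> D"
  using geometric_modulusD[OF modulus, of "\<lambda>_. e" "\<lambda>_. e" 0] e_in by auto

lemma B_const: "B (\<lambda>_. e) = 0"
  using periodic[of 1 "\<lambda>_. e"] e_in by (simp add: birkhoff_sum_def shift_def)

text \<open>\<open>B\<close> vanishes at the fixed point \<open>\<lambda>_. e\<close>, with which
  the argument shares \<open>k\<close> letters.\<close>

lemma B_prepend_bound:
  assumes "x \<in> X"
  shows "norm (B (prepend_const e k x)) \<le> D * \<rho> ^ k"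
  using geometric_modulusD[OF modulus prepend_in[OF assms], of "\<lambda>_. e" k k] e_in B_const
  by (simp add: prepend_const_def)

lemma summable_geometric_Suc: "summable (\<lambda>k. D * \<rho> ^ (Suc k + n))"
proof -
  have "summable (\<lambda>k. D * \<rho> ^ Suc n * \<rho> ^ k)"
    using \<rho> by (intro summable_mult summable_geometric) auto
  then show ?thesis by (simp add: power_add mult_ac)
qed

lemma summable_B_prepend:
  assumes "x \<in> X"
  shows "summable (\<lambda>k. B (prepend_const e (Suc k) x))"
proof (rule summable_comparison_test'[OF summable_geometric_Suc[of 0]])
  show "norm (B (prepend_const e (Suc k) x)) \<le> D * \<rho> ^ (Suc k + 0)" for k
    unfolding add_0_right by (rule B_prepend_bound[OF assms])
qed

text \<open>The backward orbits chosen for \<open>x\<close> and for \<open>shift x\<close> are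
  different, so the cohomological equation is no formal telescoping; the periodic data must relate
  them.\<close>

definition transfer :: "(nat \<Rightarrow> 'a) \<Rightarrow> real" where
  "transfer x = - (\<Sum>k. B (prepend_const e (Suc k) x))"

lemma suminf_geometric_Suc: "(\<Sum>k. D * \<rho> ^ (Suc k + n)) = D * \<rho> / (1 - \<rho>) * \<rho> ^ n"
proof -
  have "(\<Sum>k. D * \<rho> ^ (Suc k + n)) = (\<Sum>k. D * \<rho> ^ Suc n * \<rho> ^ k)"
    by (simp add: power_add mult_ac)
  also have "\<dots> = D * \<rho> ^ Suc n * (1 / (1 - \<rho>))"
    using \<rho> by (subst suminf_mult) (auto simp: suminf_geometric intro: summable_geometric)
  finally show ?thesis by simp
qed

lemma sum_geometric_Suc_le: "(\<Sum>k<m. D * \<rho> ^ (Suc k + n)) \<le> D * \<rho> / (1 - \<rho>) * \<rho> ^ n"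
  unfolding suminf_geometric_Suc[symmetric]
  using \<rho> D_nonneg by (intro sum_le_suminf summable_geometric_Suc) auto

text \<open>Prepending \<open>Suc k\<close> letters lengthens a common prefix from \<open>n\<close>
  to \<open>Suc k + n\<close>; the termwise bounds form a geometric series.\<close>

lemma geometric_modulus_transfer:
  "geometric_modulus X (D * \<rho> / (1 - \<rho>)) \<rho> transfer"
  unfolding geometric_modulus_def
proof (intro ballI allI impI)
  fix x y n
  assume x: "x \<in> X" and y: "y \<in> X" and agree: "\<forall>i<n. x i = y i"
  let ?d = "\<lambda>k. B (prepend_const e (Suc k) y) - B (prepend_const e (Suc k) x)"
  have le: "norm (?d k) \<le> D * \<rho> ^ (Suc k + n)" for k
    using geometric_modulusD[OF modulus prepend_in[OF y] prepend_in[OF x], of "Suc k + n"] agree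
    by (auto simp: prepend_const_def)
  have "transfer x - transfer y = suminf ?d"
    unfolding transfer_def using summable_B_prepend[OF x] summable_B_prepend[OF y]
    by (simp add: suminf_diff)
  also have "norm \<dots> \<le> (\<Sum>k. D * \<rho> ^ (Suc k + n))"
    by (intro norm_suminf_le le summable_geometric_Suc)
  finally show "\<bar>transfer x - transfer y\<bar> \<le> D * \<rho> / (1 - \<rho>) * \<rho> ^ n"
    unfolding suminf_geometric_Suc by simp
qed

text \<open>
  The periodic point \<open>(x\<^sub>0 \<dots> x\<^sub>m\<^sub>-\<^sub>1 e\<^sup>m)\<^sup>\<infinity>\<close> has orbit sum zero. The first half of its orbit
  shadows the orbit of the truncation \<open>x\<^sub>0 \<dots> x\<^sub>m\<^sub>-\<^sub>1 e\<^sup>\<infinity>\<close>, the second half shadows the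
  points \<open>e\<^sup>k x\<close>.
\<close>

lemma truncate_plus_prepend_bound:
  assumes x: "x \<in> X"
  shows "\<bar>birkhoff_sum shift B m (truncate_const e m x) + (\<Sum>k<m. B (prepend_const e (Suc k) x))\<bar>
    \<le> 2 * (D * \<rho> / (1 - \<rho>) * \<rho> ^ m)"
proof (cases "m = 0")
  \<comment> \<open>The word is empty and gives no period, but both sums are empty too.\<close>
  case True
  then show ?thesis using D_nonneg \<rho> by (simp add: birkhoff_sum_def)
next
  case False
  define p where "p = (\<lambda>i. truncate_const e m x (i mod (2 * m)))"
  have p: "p \<in> X"
    using truncate_in[OF x, of m] by (auto simp: p_def)
  have "birkhoff_sum shift B (m + m) p = 0"
    using False p by (intro periodic) (auto simp: funpow_shift p_def mult_2[symmetric])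
  then have zero: "(\<Sum>k<m. B (\<lambda>i. p (k + i))) + (\<Sum>k<m. B (\<lambda>i. p (m + k + i))) = 0"
    by (simp add: birkhoff_sum_def funpow_shift sum_lessThan_add)
  \<comment> \<open>Reversal pairs the shift by \<open>m + k\<close>, which has \<open>m - k\<close>
    letters \<open>e\<close> still ahead, with the prefix of length \<open>m - k\<close>.\<close>
  have reindex: "(\<Sum>k<m. f (Suc k)) = (\<Sum>k<m. f (m - k))" for f :: "nat \<Rightarrow> real"
    using sum.nat_diff_reindex[of "\<lambda>k. f (Suc k)" m] by (simp add: Suc_diff_Suc)
  have sum_bound: "\<bar>(\<Sum>k<m. f k) - (\<Sum>k<m. g k)\<bar> \<le> (\<Sum>k<m. D * \<rho> ^ (Suc k + m))"
    if "\<And>k. k < m \<Longrightarrow> \<bar>f k - g k\<bar> \<le> D * \<rho> ^ (m - k + m)" for f g :: "nat \<Rightarrow> real"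
    unfolding reindex[of "\<lambda>k. D * \<rho> ^ (k + m)"] sum_subtractf[symmetric]
    using that by (intro order_trans[OF sum_abs] sum_mono) auto
  \<comment> \<open>\<open>p\<close> and the truncation coincide below index \<open>2 * m\<close>,
    hence after a shift by \<open>k\<close> in \<open>m - k + m\<close> places.\<close>
  have first: "\<bar>(\<Sum>k<m. B (\<lambda>i. p (k + i))) - (\<Sum>k<m. B (\<lambda>i. truncate_const e m x (k + i)))\<bar>
      \<le> (\<Sum>k<m. D * \<rho> ^ (Suc k + m))"
    by (intro sum_bound geometric_modulusD[OF modulus] shift_in p truncate_in x)
      (auto simp: p_def)
  have second: "\<bar>(\<Sum>k<m. B (\<lambda>i. p (m + k + i))) - (\<Sum>k<m. B (prepend_const e (Suc k) x))\<bar>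
      \<le> (\<Sum>k<m. D * \<rho> ^ (Suc k + m))"
    unfolding reindex[of "\<lambda>k. B (prepend_const e k x)"]
  proof (intro sum_bound geometric_modulusD[OF modulus] shift_in p prepend_in x)
    fix k i
    assume k: "k < m" and i: "i < m - k + m"
    show "p (m + k + i) = prepend_const e (m - k) x i"
    proof (cases "i < m - k")
      case True
      then show ?thesis
        by (simp add: p_def truncate_const_def prepend_const_def)
    next
      case False
      \<comment> \<open>Past the remaining letters \<open>e\<close> the point \<open>p\<close>
        starts its second period and copies \<open>x\<close> for \<open>m\<close> more
        letters.\<close>
      then have "m + k + i = (i - (m - k)) + 2 * m"
        using k by simp
      moreover have "i - (m - k) < m"
        using i False by simp
      ultimately have "(m + k + i) mod (2 * m) = i - (m - k)"
        by (metis mod_add_self2 mod_less mult_2 trans_less_add1)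
      with False \<open>i - (m - k) < m\<close> show ?thesis
        by (simp add: p_def truncate_const_def prepend_const_def)
    qed
  qed
  show ?thesis
    using zero first second sum_geometric_Suc_le[of m m]
    unfolding birkhoff_sum_def funpow_shift by linarith
qed

text \<open>The orbit sums and the partial sums of the series for \<open>- transfer x\<close> cancel
  up to a multiple of \<open>\<rho> ^ m\<close>.\<close>

lemma birkhoff_sum_truncate_tendsto:
  assumes x: "x \<in> X"
  shows "(\<lambda>m. birkhoff_sum shift B m (truncate_const e m x)) \<longlonglongrightarrow> transfer x"
proof -
  let ?s = "\<lambda>m. \<Sum>k<m. B (prepend_const e (Suc k) x)"
  let ?t = "\<lambda>m. birkhoff_sum shift B m (truncate_const e m x)"
  have "(\<lambda>m. 2 * (D * \<rho> / (1 - \<rho>) * \<rho> ^ m)) \<longlonglongrightarrow> 2 * (D * \<rho> / (1 - \<rho>) * 0)"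
    using \<rho> by (intro tendsto_intros LIMSEQ_power_zero) auto
  then have lim: "(\<lambda>m. 2 * (D * \<rho> / (1 - \<rho>) * \<rho> ^ m)) \<longlonglongrightarrow> 0"
    by (simp only: mult_zero_right)
  have "(\<lambda>m. ?t m + ?s m) \<longlonglongrightarrow> 0"
    by (rule Lim_null_comparison[OF always_eventually lim])
      (use truncate_plus_prepend_bound[OF x] in \<open>simp only: real_norm_def simp_thms\<close>)
  moreover have "?s \<longlonglongrightarrow> - transfer x"
    using summable_LIMSEQ[OF summable_B_prepend[OF x]] by (simp add: transfer_def)
  ultimately have "(\<lambda>m. ?t m + ?s m - ?s m) \<longlonglongrightarrow> 0 - - transfer x"
    by (rule tendsto_diff)
  then show ?thesis by simp
qed

lemma transfer_cohomologous:
  assumes x: "x \<in> X"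
  shows "B x = transfer x - transfer (shift x)"
proof -
  have sx: "shift x \<in> X"
    using x by (auto simp: shift_def)
  \<comment> \<open>Deleting the first letter of the truncation of length \<open>Suc m\<close> gives
    exactly the truncation of \<open>shift x\<close> of length \<open>m\<close>, so the recursion
    has no error term and only the limit remains to be taken.\<close>
  have step: "birkhoff_sum shift B (Suc m) (truncate_const e (Suc m) x) =
      B (truncate_const e (Suc m) x) + birkhoff_sum shift B m (truncate_const e m (shift x))" for m
  proof -
    have "shift (truncate_const e (Suc m) x) = truncate_const e m (shift x)"
      by (auto simp: shift_def truncate_const_def)
    then show ?thesis
      by (simp add: birkhoff_sum_def sum.lessThan_Suc_shift funpow_swap1 del: sum.lessThan_Suc)
  qed
  have "(\<lambda>m. B (truncate_const e m x) - B x) \<longlonglongrightarrow> 0"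
  proof (rule Lim_null_comparison)
    show "eventually (\<lambda>m. norm (B (truncate_const e m x) - B x) \<le> D * \<rho> ^ m) sequentially"
      using geometric_modulusD[OF modulus truncate_in[OF x] x]
      by (auto simp: truncate_const_def)
    have "(\<lambda>m. D * \<rho> ^ m) \<longlonglongrightarrow> D * 0"
      using \<rho> by (intro tendsto_intros LIMSEQ_power_zero) auto
    then show "(\<lambda>m. D * \<rho> ^ m) \<longlonglongrightarrow> 0" by simp
  qed
  then have "(\<lambda>m. B (truncate_const e m x)) \<longlonglongrightarrow> B x"
    by (rule LIM_zero_cancel)
  then have "(\<lambda>m. B (truncate_const e (Suc m) x) +
      birkhoff_sum shift B m (truncate_const e m (shift x))) \<longlonglongrightarrow> B x + transfer (shift x)"
    by (intro tendsto_add LIMSEQ_Suc birkhoff_sum_truncate_tendsto sx)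
  moreover have "(\<lambda>m. B (truncate_const e (Suc m) x) +
      birkhoff_sum shift B m (truncate_const e m (shift x))) \<longlonglongrightarrow> transfer x"
    using LIMSEQ_Suc[OF birkhoff_sum_truncate_tendsto[OF x]] unfolding step .
  ultimately have "B x + transfer (shift x) = transfer x"
    by (rule LIMSEQ_unique)
  then show ?thesis by simp
qed

end

section \<open>Conjugating a permutive cellular map to the full shift\<close>

text \<open>The leftmost column of the space-time diagram whose row \<open>k\<close> is the
  \<open>k\<close>-th iterate.\<close>

definition orbit_trace :: "('a \<Rightarrow> 'a \<Rightarrow> 'a) \<Rightarrow> (nat \<Rightarrow> 'a) \<Rightarrow> nat \<Rightarrow> 'a" where
  "orbit_trace \<phi> x = (\<lambda>k. ((cellular_map \<phi> ^^ k) x) 0)"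

text \<open>Each application of the rule looks one coordinate further right, so \<open>k\<close>
  steps use up \<open>k\<close> letters of the common prefix.\<close>

lemma funpow_cellular_map_agree:
  assumes "\<And>i. i < n + k \<Longrightarrow> x i = y i" "i < n"
  shows "(cellular_map \<phi> ^^ k) x i = (cellular_map \<phi> ^^ k) y i"
  using assms
proof (induction k arbitrary: n i)
  case (Suc k)
  have "(cellular_map \<phi> ^^ k) x j = (cellular_map \<phi> ^^ k) y j" if "j < Suc n" for j
    using Suc.prems(1) that by (intro Suc.IH[of "Suc n"]) auto
  then show ?case
    using Suc.prems(2) by (simp add: cellular_map_def[of \<phi> "(cellular_map \<phi> ^^ k) _"])
qed simp

lemma orbit_trace_agree:
  assumes "\<And>i. i < n \<Longrightarrow> x i = y i" "i < n"
  shows "orbit_trace \<phi> x i = orbit_trace \<phi> y i"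
  unfolding orbit_trace_def
  by (rule funpow_cellular_map_agree[where n = 1]) (use assms in auto)

lemma orbit_trace_cellular_map: "orbit_trace \<phi> (cellular_map \<phi> x) = shift (orbit_trace \<phi> x)"
  by (simp add: orbit_trace_def shift_def funpow_swap1)

text \<open>
  For a permutive rule, \<open>untrace_row S \<phi> z i k\<close> is entry \<open>i\<close> of the \<open>k\<close>-th iterate of the point with
  trace \<open>z\<close>.
\<close>

primrec untrace_row :: "'a set \<Rightarrow> ('a \<Rightarrow> 'a \<Rightarrow> 'a) \<Rightarrow> (nat \<Rightarrow> 'a) \<Rightarrow> nat \<Rightarrow> nat \<Rightarrow> 'a" where
  "untrace_row S \<phi> z 0 = z"
| "untrace_row S \<phi> z (Suc i) = (\<lambda>k.
     inv_into S (\<phi> (untrace_row S \<phi> z i k)) (untrace_row S \<phi> z i (Suc k)))"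

definition untrace :: "'a set \<Rightarrow> ('a \<Rightarrow> 'a \<Rightarrow> 'a) \<Rightarrow> (nat \<Rightarrow> 'a) \<Rightarrow> nat \<Rightarrow> 'a" where
  "untrace S \<phi> z = (\<lambda>i. untrace_row S \<phi> z i 0)"

text \<open>Each new column looks one time step ahead, so column \<open>i\<close> at time
  \<open>k\<close> sees only \<open>z k\<close> up to \<open>z (k + i)\<close>.\<close>

lemma untrace_row_agree:
  assumes "\<And>j. j \<le> i + k \<Longrightarrow> z j = w j"
  shows "untrace_row S \<phi> z i k = untrace_row S \<phi> w i k"
  using assms by (induction i arbitrary: k) auto

lemma untrace_agree:
  assumes "\<And>j. j < n \<Longrightarrow> z j = w j" "i < n"
  shows "untrace S \<phi> z i = untrace S \<phi> w i"
  unfolding untrace_def by (rule untrace_row_agree) (use assms in auto)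

lemma untrace_row_shift: "untrace_row S \<phi> (shift z) i k = untrace_row S \<phi> z i (Suc k)"
  by (induction i arbitrary: k) (auto simp: shift_def)

locale permutive_rule =
  fixes S :: "'a set" and \<phi> :: "'a \<Rightarrow> 'a \<Rightarrow> 'a"
  assumes permutive: "\<And>a. a \<in> S \<Longrightarrow> bij_betw (\<phi> a) S S"
begin

lemma rule_in: "a \<in> S \<Longrightarrow> b \<in> S \<Longrightarrow> \<phi> a b \<in> S"
  using permutive by (meson bij_betwE)

lemma cellular_map_in: "cellular_map \<phi> \<in> (UNIV \<rightarrow> S) \<rightarrow> (UNIV \<rightarrow> S)"
  by (auto simp: cellular_map_def rule_in Pi_iff)

lemma orbit_trace_in: "x \<in> UNIV \<rightarrow> S \<Longrightarrow> orbit_trace \<phi> x \<in> UNIV \<rightarrow> S"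
  using funpow_in[OF cellular_map_in] by (auto simp: orbit_trace_def Pi_iff)

lemma untrace_row_in:
  assumes "z \<in> UNIV \<rightarrow> S"
  shows "untrace_row S \<phi> z i k \<in> S"
proof (induction i arbitrary: k)
  case 0
  then show ?case using assms by auto
next
  case (Suc i)
  have "bij_betw (\<phi> (untrace_row S \<phi> z i k)) S S"
    using Suc by (rule permutive)
  then show ?case
    using Suc[of "Suc k"] by (simp add: bij_betw_def inv_into_into)
qed

lemma untrace_in: "z \<in> UNIV \<rightarrow> S \<Longrightarrow> untrace S \<phi> z \<in> UNIV \<rightarrow> S"
  by (auto simp: untrace_def untrace_row_in)

text \<open>Surjectivity of \<open>\<phi> a\<close> makes the chosen entries satisfy the rule:
  applying it to columns \<open>i\<close> and \<open>Suc i\<close> at time 0 returns column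
  \<open>i\<close> at time 1.\<close>

lemma cellular_map_untrace:
  assumes z: "z \<in> UNIV \<rightarrow> S"
  shows "cellular_map \<phi> (untrace S \<phi> z) = untrace S \<phi> (shift z)"
proof
  fix i
  have "bij_betw (\<phi> (untrace_row S \<phi> z i 0)) S S"
    by (intro permutive untrace_row_in z)
  then show "cellular_map \<phi> (untrace S \<phi> z) i = untrace S \<phi> (shift z) i"
    using untrace_row_in[OF z, of i "Suc 0"]
    by (simp add: cellular_map_def untrace_def untrace_row_shift bij_betw_inv_into_right)
qed

lemma funpow_cellular_map_untrace:
  assumes z: "z \<in> UNIV \<rightarrow> S"
  shows "(cellular_map \<phi> ^^ n) (untrace S \<phi> z) = untrace S \<phi> ((shift ^^ n) z)"
proof (induction n)
  case (Suc n)
  have "(shift ^^ n) z \<in> UNIV \<rightarrow> S"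
    using z by (auto simp: funpow_shift)
  with Suc show ?case by (simp add: cellular_map_untrace)
qed simp

text \<open>Injectivity of \<open>\<phi> a\<close> enters here: in a genuine orbit, column
  \<open>i\<close> at times \<open>k\<close> and \<open>Suc k\<close> determines column
  \<open>Suc i\<close> at time \<open>k\<close>.\<close>

lemma untrace_row_orbit_trace:
  assumes x: "x \<in> UNIV \<rightarrow> S"
  shows "untrace_row S \<phi> (orbit_trace \<phi> x) i k = (cellular_map \<phi> ^^ k) x i"
proof (induction i arbitrary: k)
  case (Suc i)
  have "(cellular_map \<phi> ^^ k) x \<in> UNIV \<rightarrow> S"
    using cellular_map_in x by (rule funpow_in)
  then show ?case
    using permutive[of "(cellular_map \<phi> ^^ k) x i"]
    by (simp add: Suc cellular_map_def[of \<phi> "(cellular_map \<phi> ^^ k) x"] Pi_iff bij_betw_inv_into_left)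
qed (simp add: orbit_trace_def)

lemma untrace_orbit_trace: "x \<in> UNIV \<rightarrow> S \<Longrightarrow> untrace S \<phi> (orbit_trace \<phi> x) = x"
  by (simp add: untrace_def untrace_row_orbit_trace)

text \<open>The potential is carried to the shift by \<open>untrace\<close>, which sends periodic
  points to periodic points of the same period; the transfer function is carried back by
  \<open>orbit_trace\<close>.\<close>

lemma livsic:
  assumes \<rho>: "0 < \<rho>" "\<rho> < 1" and A: "geometric_modulus (UNIV \<rightarrow> S) D \<rho> A"
    and periodic: "\<And>n x. 1 \<le> n \<Longrightarrow> x \<in> UNIV \<rightarrow> S \<Longrightarrow> (cellular_map \<phi> ^^ n) x = x \<Longrightarrow>
      birkhoff_sum (cellular_map \<phi>) A n x = 0"
  obtains h E where "geometric_modulus (UNIV \<rightarrow> S) E \<rho> h"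
    "\<And>x. x \<in> UNIV \<rightarrow> S \<Longrightarrow> A x = h x - h (cellular_map \<phi> x)"
proof (cases "S = {}")
  \<comment> \<open>Without letters there are no points, so any \<open>h\<close> will do.\<close>
  case True
  then show ?thesis
    using that by (force simp: geometric_modulus_def)
next
  case False
  then obtain e where e: "e \<in> S" by blast
  define B where "B = A \<circ> untrace S \<phi>"
  interpret shift_potential S e B D \<rho>
  proof
    show "geometric_modulus (UNIV \<rightarrow> S) D \<rho> B"
      unfolding geometric_modulus_def B_def o_def
    proof (intro ballI allI impI geometric_modulusD[OF A] untrace_in)
      fix x y :: "nat \<Rightarrow> 'a" and n i
      assume "\<forall>j<n. x j = y j" "i < n"
      then show "untrace S \<phi> x i = untrace S \<phi> y i"
        by (intro untrace_agree) auto
    qed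
  next
    fix n :: nat and x :: "nat \<Rightarrow> 'a"
    assume n: "1 \<le> n" and x: "x \<in> UNIV \<rightarrow> S" and per: "(shift ^^ n) x = x"
    have "birkhoff_sum shift B n x = birkhoff_sum (cellular_map \<phi>) A n (untrace S \<phi> x)"
      by (simp add: birkhoff_sum_def B_def funpow_cellular_map_untrace[OF x])
    also have "\<dots> = 0"
      by (intro periodic n untrace_in x) (simp add: funpow_cellular_map_untrace[OF x] per)
    finally show "birkhoff_sum shift B n x = 0" .
  qed (use e \<rho> in auto)
  show ?thesis
  proof (rule that)
    show "geometric_modulus (UNIV \<rightarrow> S) (D * \<rho> / (1 - \<rho>)) \<rho> (transfer \<circ> orbit_trace \<phi>)"
      unfolding geometric_modulus_def o_def
    proof (intro ballI allI impI geometric_modulusD[OF geometric_modulus_transfer] orbit_trace_in)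
      fix x y :: "nat \<Rightarrow> 'a" and n i
      assume "\<forall>j<n. x j = y j" "i < n"
      then show "orbit_trace \<phi> x i = orbit_trace \<phi> y i"
        by (intro orbit_trace_agree) auto
    qed
    show "A x = (transfer \<circ> orbit_trace \<phi>) x - (transfer \<circ> orbit_trace \<phi>) (cellular_map \<phi> x)"
      if "x \<in> UNIV \<rightarrow> S" for x
      using transfer_cohomologous[OF orbit_trace_in[OF that]]
      by (simp add: B_def untrace_orbit_trace[OF that] orbit_trace_cellular_map)
  qed
qed

end

section \<open>The equivalence on \<open>Omega r\<close>\<close>

theorem corollary5p5:
  fixes r :: nat and \<theta> :: real
    and \<phi> :: "nat \<Rightarrow> nat \<Rightarrow> nat" and A :: "(nat \<Rightarrow> nat) \<Rightarrow> real"
  assumes "0 < \<theta>" and "\<theta> < 1"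
    and "\<And>a. a \<in> {1..r} \<Longrightarrow> bij_betw (\<phi> a) {1..r} {1..r}"
    and "holder_on (Omega r) (seq_dist \<theta>) A"
    and "has_dense_orbit (Omega_top r \<theta>) (cellular_map \<phi>)"
  shows "is_coboundary (Omega_top r \<theta>) (cellular_map \<phi>) A \<longleftrightarrow>
    (\<forall>n\<ge>1. \<forall>x\<in>Omega r. (cellular_map \<phi> ^^ n) x = x \<longrightarrow>
      birkhoff_sum (cellular_map \<phi>) A n x = 0)"
proof -
  interpret permutive_rule "{1..r}" \<phi>
    by unfold_locales (rule assms(3))
  have Omega: "Omega r = UNIV \<rightarrow> {1..r}"
    by (auto simp: Omega_def Pi_iff)
  have top: "topspace (Omega_top r \<theta>) = Omega r"
    unfolding Omega_top_def
    by (rule Metric_space.topspace_mtopology[OF Metric_space_seq_dist[OF assms(1,2)]])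
  show ?thesis
  proof
    assume "is_coboundary (Omega_top r \<theta>) (cellular_map \<phi>) A"
    then obtain h where "\<And>x. x \<in> Omega r \<Longrightarrow> A x = h x - h (cellular_map \<phi> x)"
      by (auto simp: is_coboundary_def top)
    then show "\<forall>n\<ge>1. \<forall>x\<in>Omega r. (cellular_map \<phi> ^^ n) x = x \<longrightarrow>
        birkhoff_sum (cellular_map \<phi>) A n x = 0"
      using birkhoff_sum_coboundary[OF cellular_map_in] by (simp add: Omega)
  next
    assume *: "\<forall>n\<ge>1. \<forall>x\<in>Omega r. (cellular_map \<phi> ^^ n) x = x \<longrightarrow>
        birkhoff_sum (cellular_map \<phi>) A n x = 0"
    obtain D \<rho> where \<rho>: "0 < \<rho>" "\<rho> < 1" and A: "geometric_modulus (UNIV \<rightarrow> {1..r}) D \<rho> A"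
      using holder_on_imp_geometric_modulus[OF assms(1,2,4)] unfolding Omega .
    \<comment> \<open>The solution has a geometric modulus with the same \<open>\<rho>\<close> as
      \<open>A\<close>, which is what makes it continuous.\<close>
    obtain h E where h: "geometric_modulus (Omega r) E \<rho> h"
      "\<And>x. x \<in> Omega r \<Longrightarrow> A x = h x - h (cellular_map \<phi> x)"
    proof (rule livsic[OF \<rho> A])
      show "birkhoff_sum (cellular_map \<phi>) A n x = 0"
        if "1 \<le> n" "x \<in> UNIV \<rightarrow> {1..r}" "(cellular_map \<phi> ^^ n) x = x" for n x
        using * that by (simp add: Omega)
    qed (simp add: Omega)
    show "is_coboundary (Omega_top r \<theta>) (cellular_map \<phi>) A"
      unfolding is_coboundary_def top
      using continuous_map_geometric_modulus[OF assms(1,2) \<rho> h(1)] h(2)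
      by (auto simp: Omega_top_def)
  qed
qed

end
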